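(* Let $\varphi$ be a Boolean formula over the finite set of Boolean variables $\Sigma$ and let $\ell$ be a literal of a variable in $\Sigma$. Then $M(\forall \ell\cdot\varphi)\subseteq M(\varphi)$. Moreover, for every world $\omega$: $\omega\in M(\varphi)$ and $\omega\notin M(\forall \ell\cdot\varphi)$ if and only if $\omega$ is an $\bar{\ell}$-boundary model of $\varphi$.
   Context: $\Sigma$ is a fixed finite set of Boolean variables. A literal of variable $X$ is $x$ (positive) or $\bar{x}$ (negative); $\bar{\ell}$ denotes the complement of literal $\ell$. A world $\omega$ is a truth assignment to $\Sigma$, identified with the set of literals (exactly one per variable) that it makes true. $M(\varphi)$ is the set of models (satisfying worlds) of $\varphi$. $\omega[\ell]$ is the world obtained from $\omega$ by replacing its literal of the variable of $\ell$ by $\ell$. A world $\omega$ is an $\ell$-boundary model of $\varphi$ iff $\ell\in\omega$, $\omega\models\varphi$ and $\omega[\bar{\ell}]\models\neg\varphi$. Conditioning: $\varphi|x$ (resp. $\varphi|\bar{x}$) is obtained by replacing every occurrence of variable $X$ in $\varphi$ with true (resp. false). Universal literal quantification is defined by $\forall \ell\cdot\varphi = (\ell\vee(\varphi|\bar{\ell}))\wedge(\varphi|\ell)$. *)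

theory Defs
  imports Main
begin

datatype 'v literal = Pos 'v | Neg 'v

fun var_of :: "'v literal \<Rightarrow> 'v" where
  "var_of (Pos X) = X"
| "var_of (Neg X) = X"

fun compl_lit :: "'v literal \<Rightarrow> 'v literal" where
  "compl_lit (Pos X) = Neg X"
| "compl_lit (Neg X) = Pos X"

datatype 'v form =
    FTrue
  | FFalse
  | FVar 'v
  | FNot "'v form"
  | FAnd "'v form" "'v form"
  | FOr "'v form" "'v form"
  | FImp "'v form" "'v form"
  | FIff "'v form" "'v form"

(* The generated set function collects the variables occurring in a formula. *)
abbreviation vars_form :: "'v form \<Rightarrow> 'v set" where
  "vars_form \<equiv> set_form"

fun lit_form :: "'v literal \<Rightarrow> 'v form" where
  "lit_form (Pos X) = FVar X"
| "lit_form (Neg X) = FNot (FVar X)"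

(* A world is identified with the set of literals that it makes true. *)
definition is_world :: "'v set \<Rightarrow> 'v literal set \<Rightarrow> bool" where
  "is_world \<Sigma> \<omega> \<longleftrightarrow>
     (\<forall>l\<in>\<omega>. var_of l \<in> \<Sigma>) \<and> (\<forall>X\<in>\<Sigma>. \<exists>!l. l \<in> \<omega> \<and> var_of l = X)"

fun sat :: "'v literal set \<Rightarrow> 'v form \<Rightarrow> bool" where
  "sat \<omega> FTrue \<longleftrightarrow> True"
| "sat \<omega> FFalse \<longleftrightarrow> False"
| "sat \<omega> (FVar X) \<longleftrightarrow> Pos X \<in> \<omega>"
| "sat \<omega> (FNot \<phi>) \<longleftrightarrow> \<not> sat \<omega> \<phi>"
| "sat \<omega> (FAnd \<phi> \<psi>) \<longleftrightarrow> sat \<omega> \<phi> \<and> sat \<omega> \<psi>"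
| "sat \<omega> (FOr \<phi> \<psi>) \<longleftrightarrow> sat \<omega> \<phi> \<or> sat \<omega> \<psi>"
| "sat \<omega> (FImp \<phi> \<psi>) \<longleftrightarrow> (sat \<omega> \<phi> \<longrightarrow> sat \<omega> \<psi>)"
| "sat \<omega> (FIff \<phi> \<psi>) \<longleftrightarrow> (sat \<omega> \<phi> \<longleftrightarrow> sat \<omega> \<psi>)"

definition models :: "'v set \<Rightarrow> 'v form \<Rightarrow> 'v literal set set" where
  "models \<Sigma> \<phi> = {\<omega>. is_world \<Sigma> \<omega> \<and> sat \<omega> \<phi>}"

definition set_lit :: "'v literal set \<Rightarrow> 'v literal \<Rightarrow> 'v literal set" where
  "set_lit \<omega> l = insert l {k \<in> \<omega>. var_of k \<noteq> var_of l}"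

definition boundary_model :: "'v set \<Rightarrow> 'v literal \<Rightarrow> 'v form \<Rightarrow> 'v literal set \<Rightarrow> bool" where
  "boundary_model \<Sigma> l \<phi> \<omega> \<longleftrightarrow>
     is_world \<Sigma> \<omega> \<and> l \<in> \<omega> \<and> sat \<omega> \<phi> \<and> sat (set_lit \<omega> (compl_lit l)) (FNot \<phi>)"

fun subst_var :: "'v \<Rightarrow> 'v form \<Rightarrow> 'v form \<Rightarrow> 'v form" where
  "subst_var X \<chi> FTrue = FTrue"
| "subst_var X \<chi> FFalse = FFalse"
| "subst_var X \<chi> (FVar Y) = (if Y = X then \<chi> else FVar Y)"
| "subst_var X \<chi> (FNot \<phi>) = FNot (subst_var X \<chi> \<phi>)"
| "subst_var X \<chi> (FAnd \<phi> \<psi>) = FAnd (subst_var X \<chi> \<phi>) (subst_var X \<chi> \<psi>)"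
| "subst_var X \<chi> (FOr \<phi> \<psi>) = FOr (subst_var X \<chi> \<phi>) (subst_var X \<chi> \<psi>)"
| "subst_var X \<chi> (FImp \<phi> \<psi>) = FImp (subst_var X \<chi> \<phi>) (subst_var X \<chi> \<psi>)"
| "subst_var X \<chi> (FIff \<phi> \<psi>) = FIff (subst_var X \<chi> \<phi>) (subst_var X \<chi> \<psi>)"

fun condition :: "'v form \<Rightarrow> 'v literal \<Rightarrow> 'v form" where
  "condition \<phi> (Pos X) = subst_var X FTrue \<phi>"
| "condition \<phi> (Neg X) = subst_var X FFalse \<phi>"

definition forall_lit :: "'v literal \<Rightarrow> 'v form \<Rightarrow> 'v form" where
  "forall_lit l \<phi> =
     FAnd (FOr (lit_form l) (condition \<phi> (compl_lit l))) (condition \<phi> l)"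

end

theory Submission
  imports Defs
begin

text \<open>Conditioning on a literal amounts to evaluating in the world flipped to it
  (\<open>sat_condition\<close>). Hence a world \<omega> satisfies
  \<open>forall_lit l \<phi>\<close> exactly when both \<omega> and
  \<open>set_lit \<omega> l\<close> satisfy \<phi> (\<open>sat_forall_lit\<close>), which gives the
  inclusion. A model of \<phi> is lost just when setting \<open>l\<close> falsifies \<phi>; then
  setting \<open>l\<close> changed the world, so \<omega> contains the complement of
  \<open>l\<close> and lies on its boundary.\<close>

lemma compl_lit_compl_lit [simp]: "compl_lit (compl_lit l) = l"
  by (cases l) simp_all

text \<open>No world is required: \<open>sat\<close> inspects positive literals only, and
  \<open>set_lit\<close> decides \<open>Pos X\<close> as the substituted constant does while leaving
  every other variable alone.\<close>

lemma sat_condition: "sat \<omega> (condition \<phi> l) \<longleftrightarrow> sat (set_lit \<omega> l) \<phi>"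
proof (cases l)
  case (Pos X)
  have "sat \<omega> (subst_var X FTrue \<phi>) \<longleftrightarrow> sat (set_lit \<omega> (Pos X)) \<phi>"
    by (induction \<phi>) (auto simp: set_lit_def)
  then show ?thesis using Pos by simp
next
  case (Neg X)
  have "sat \<omega> (subst_var X FFalse \<phi>) \<longleftrightarrow> sat (set_lit \<omega> (Neg X)) \<phi>"
    by (induction \<phi>) (auto simp: set_lit_def)
  then show ?thesis using Neg by simp
qed

lemma is_world_compl_iff:
  assumes "is_world \<Sigma> \<omega>" and "var_of l \<in> \<Sigma>"
  shows "compl_lit l \<in> \<omega> \<longleftrightarrow> l \<notin> \<omega>"
proof -
  have ex1: "\<exists>!k. k \<in> \<omega> \<and> var_of k = var_of l"
    using assms by (auto simp: is_world_def)
  have var: "k = l \<or> k = compl_lit l" if "var_of k = var_of l" for k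
    using that by (cases k; cases l) simp_all
  have "var_of (compl_lit l) = var_of l" "compl_lit l \<noteq> l"
    by (cases l; simp)+
  then show ?thesis using ex1 var by metis
qed

text \<open>A world has a single literal per variable, so the only literal removed is
  \<open>l\<close>, which is put back.\<close>

lemma set_lit_idem:
  assumes "is_world \<Sigma> \<omega>" and "l \<in> \<omega>"
  shows "set_lit \<omega> l = \<omega>"
proof -
  have "var_of l \<in> \<Sigma>" using assms by (auto simp: is_world_def)
  then have "\<exists>!k. k \<in> \<omega> \<and> var_of k = var_of l"
    using assms by (auto simp: is_world_def)
  then have "k = l" if "k \<in> \<omega>" "var_of k = var_of l" for k
    using that assms(2) by blast
  then show ?thesis using assms(2) by (auto simp: set_lit_def)
qed

lemma sat_lit_form:
  assumes "is_world \<Sigma> \<omega>" and "var_of l \<in> \<Sigma>"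
  shows "sat \<omega> (lit_form l) \<longleftrightarrow> l \<in> \<omega>"
  using is_world_compl_iff[OF assms] by (cases l) auto

lemma sat_forall_lit:
  assumes "is_world \<Sigma> \<omega>" and "var_of l \<in> \<Sigma>"
  shows "sat \<omega> (forall_lit l \<phi>) \<longleftrightarrow> sat \<omega> \<phi> \<and> sat (set_lit \<omega> l) \<phi>"
proof (cases "l \<in> \<omega>")
  case True
  \<comment> \<open>The disjunction holds through \<open>l\<close>, and \<omega> is its own flip to
    \<open>l\<close>, so both sides reduce to \<open>sat \<omega> \<phi>\<close>.\<close>
  then show ?thesis
    using sat_lit_form[OF assms] set_lit_idem[OF assms(1)]
    by (simp add: forall_lit_def sat_condition)
next
  case False
  then have "compl_lit l \<in> \<omega>" using is_world_compl_iff[OF assms] by simp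
  \<comment> \<open>Now \<omega> is its own flip to \<open>compl_lit l\<close>, so the disjunction
    reduces to \<open>sat \<omega> \<phi>\<close>.\<close>
  with False show ?thesis
    using sat_lit_form[OF assms] set_lit_idem[OF assms(1)]
    by (simp add: forall_lit_def sat_condition)
qed

theorem theorem2:
  fixes \<Sigma> :: "'v set" and \<phi> :: "'v form" and l :: "'v literal"
  assumes "finite \<Sigma>"
    and "vars_form \<phi> \<subseteq> \<Sigma>"
    and "var_of l \<in> \<Sigma>"
  shows "models \<Sigma> (forall_lit l \<phi>) \<subseteq> models \<Sigma> \<phi> \<and>
    (\<forall>\<omega>. is_world \<Sigma> \<omega> \<longrightarrow>
      (\<omega> \<in> models \<Sigma> \<phi> \<and> \<omega> \<notin> models \<Sigma> (forall_lit l \<phi>)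
        \<longleftrightarrow> boundary_model \<Sigma> (compl_lit l) \<phi> \<omega>))"
proof (intro conjI allI impI)
  show "models \<Sigma> (forall_lit l \<phi>) \<subseteq> models \<Sigma> \<phi>"
    using sat_forall_lit[OF _ assms(3)] by (auto simp: models_def)
next
  fix \<omega>
  assume w: "is_world \<Sigma> \<omega>"
  \<comment> \<open>Otherwise \<open>l\<close> would be in \<omega>, and setting it could not change
    the truth of \<phi>.\<close>
  have "compl_lit l \<in> \<omega>" if "sat \<omega> \<phi>" "\<not> sat (set_lit \<omega> l) \<phi>"
    using that set_lit_idem[OF w] is_world_compl_iff[OF w assms(3)] by metis
  \<comment> \<open>The boundary condition for \<open>compl_lit l\<close> flips to its complement,
    which simplifies to \<open>l\<close>.\<close>
  then show "\<omega> \<in> models \<Sigma> \<phi> \<and> \<omega> \<notin> models \<Sigma> (forall_lit l \<phi>)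
      \<longleftrightarrow> boundary_model \<Sigma> (compl_lit l) \<phi> \<omega>"
    using w sat_forall_lit[OF w assms(3)]
    by (auto simp: models_def boundary_model_def)
qed

end
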